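(* Let $D\subset\mathbb{R}^m$ and $E\subset\mathbb{R}^r$ be compact sets with Lipschitz boundaries and let $\delta>0$. Let $\alpha\in(0,1]$, fix $R>0$, and define $\mathcal{H}_R^\alpha=\{f\in C^{0,\alpha}(D\times E):\|f\|_{C^{0,\alpha}(D\times E)}\le R\}$. For any $(p,y)$ and $(q,y')$ belonging to $(\mathcal{X}_\delta\cap\mathcal{H}_R^\alpha)\times E$, $$\|\Psi^\star(p,y)-\Psi^\star(q,y')\|_{C(D)}\le\frac{1+2R}{\delta}\Bigl(1+\frac{|D|R}{\delta}\Bigr)\bigl\|(p,y)-(q,y')\bigr\|^\alpha_{C(D\times E)\times E} .$$
   Context: $C(\cdot)$ carries the supremum norm; $|D|$ is the Lebesgue measure of $D$; $\|(\rho,y)\|_{C(D\times E)\times E}=\max(\|\rho\|_{C(D\times E)},\|y\|)$ with $\|y\|$ Euclidean. For compact $B\subset\mathbb{R}^k$, $\|f\|_{C^{0,\alpha}(B)}=\max\bigl(\sup_B|f|,\ \sup_{x\ne x'\in B}|f(x)-f(x')|/|x-x'|^\alpha\bigr)$ and $C^{0,\alpha}(B)$ is the set of $f\in C(B)$ for which this is finite. $C_{\mathrm{ac}}(D\times E)$ is the set of $\rho\in C(D\times E)$ with $\rho\ge0$ and $\int_{D\times E}\rho(z)\,dz=1$. For such $\rho$, $m_\rho(y)=\int_D\rho(x,y)\,dx$. $\mathcal{X}_\delta=\{\rho\in C_{\mathrm{ac}}(D\times E):\inf_{y\in E}m_\rho(y)\ge\delta\}$. The in-context conditioning operator is $\Psi^\star:\mathcal{X}_\delta\times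 E\to C(D)$, $\Psi^\star(\rho,y)(x)=\rho(x,y)/m_\rho(y)$. *)

theory Defs
  imports "HOL-Analysis.Analysis"
begin

text \<open>
  An element of \<open>C(B)\<close> is represented by a total function that is \<^const>\<open>continuous_on\<close> \<open>B\<close>;
  its values outside \<open>B\<close> play no role in any of the notions below.
\<close>

text \<open>
  Near each boundary point, \<open>D\<close> is the closed region on one side of the graph of a Lipschitz
  function.  The unit vector \<open>u\<close> is the last axis of the rotated coordinate system; the
  hyperplane orthogonal to \<open>u\<close> takes the place of \<open>\<real>\<^sup>m\<^sup>-\<^sup>1\<close>, and \<open>z - (z \<bullet> u) *\<^sub>R u\<close> is the
  orthogonal projection of \<open>z\<close> onto it.  The inequality is not strict because \<open>D\<close> is closed.
\<close>

definition lipschitz_boundary :: "'a::euclidean_space set \<Rightarrow> bool" where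
  "lipschitz_boundary D \<longleftrightarrow>
     (\<forall>x\<in>frontier D. \<exists>\<epsilon>>0. \<exists>u L. \<exists>g :: 'a \<Rightarrow> real.
        norm u = 1 \<and> L-lipschitz_on {w. w \<bullet> u = 0} g \<and>
        D \<inter> ball x \<epsilon> = {z \<in> ball x \<epsilon>. g (z - (z \<bullet> u) *\<^sub>R u) \<le> z \<bullet> u})"

definition sup_norm :: "'a set \<Rightarrow> ('a \<Rightarrow> real) \<Rightarrow> real" where
  "sup_norm B f = (SUP x\<in>B. \<bar>f x\<bar>)"

definition prod_norm ::
  "'a set \<Rightarrow> 'b set \<Rightarrow> ('a \<times> 'b \<Rightarrow> real) \<times> 'b::real_normed_vector \<Rightarrow> real" where
  "prod_norm D E = (\<lambda>(\<rho>, y). max (sup_norm (D \<times> E) \<rho>) (norm y))"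

text \<open>Valued in \<^typ>\<open>ennreal\<close> so that both suprema may be infinite.\<close>

definition holder_norm :: "real \<Rightarrow> 'a::euclidean_space set \<Rightarrow> ('a \<Rightarrow> real) \<Rightarrow> ennreal" where
  "holder_norm \<alpha> B f =
     max (SUP x\<in>B. ennreal \<bar>f x\<bar>)
         (SUP (x, x')\<in>{(x, x'). x \<in> B \<and> x' \<in> B \<and> x \<noteq> x'}.
            ennreal (\<bar>f x - f x'\<bar> / norm (x - x') powr \<alpha>))"

definition holder_space :: "real \<Rightarrow> 'a::euclidean_space set \<Rightarrow> ('a \<Rightarrow> real) set" where
  "holder_space \<alpha> B = {f. continuous_on B f \<and> holder_norm \<alpha> B f < \<infinity>}"

definition holder_ball :: "real \<Rightarrow> real \<Rightarrow> 'a::euclidean_space set \<Rightarrow> ('a \<Rightarrow> real) set" where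
  "holder_ball \<alpha> R B = {f \<in> holder_space \<alpha> B. holder_norm \<alpha> B f \<le> ennreal R}"

definition C_ac :: "'a::euclidean_space set \<Rightarrow> ('a \<Rightarrow> real) set" where
  "C_ac B = {\<rho>. continuous_on B \<rho> \<and> (\<forall>z\<in>B. 0 \<le> \<rho> z) \<and> (LINT z:B|lborel. \<rho> z) = 1}"

definition marginal :: "'a::euclidean_space set \<Rightarrow> ('a \<times> 'b \<Rightarrow> real) \<Rightarrow> 'b \<Rightarrow> real" where
  "marginal D \<rho> y = (LINT x:D|lborel. \<rho> (x, y))"

definition X_space ::
  "'a::euclidean_space set \<Rightarrow> 'b::euclidean_space set \<Rightarrow> real \<Rightarrow> ('a \<times> 'b \<Rightarrow> real) set" where
  "X_space D E \<delta> = {\<rho> \<in> C_ac (D \<times> E). \<delta> \<le> (INF y\<in>E. marginal D \<rho> y)}"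

definition Psi_star ::
  "'a::euclidean_space set \<Rightarrow> ('a \<times> 'b \<Rightarrow> real) \<times> 'b \<Rightarrow> 'a \<Rightarrow> real" where
  "Psi_star D = (\<lambda>(\<rho>, y) x. \<rho> (x, y) / marginal D \<rho> y)"

end

theory Submission
  imports Defs
begin

text \<open>
  With \<open>N\<close> the norm of the difference, \<open>\<bar>p (x, y) - q (x, y')\<bar> \<le> K\<close> for
  \<open>K = (1 + 2R) N\<^sup>\<alpha>\<close>: the step from \<open>y\<close> to \<open>y'\<close> costs \<open>R N\<^sup>\<alpha>\<close> by Hoelder continuity, and the step
  from \<open>p\<close> to \<open>q\<close> costs \<open>t = \<bar>p (x, y) - q (x, y)\<bar> \<le> N\<close> where, since \<open>p\<close> and \<open>q\<close> take values in \<open>[0, R]\<close>, also \<open>t \<le> R\<close>,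
  whence \<open>t \<le> (1 + R) t\<^sup>\<alpha>\<close>.  Integration over \<open>D\<close> bounds the difference of the marginals by
  \<open>\<bar>D\<bar> K\<close>, and the quotients are compared by \<open>a/m - b/n = (a - b)/m + b (n - m)/(m n)\<close>.
\<close>

text \<open>A real supremum dominates its members only for a family bounded above; compactness of
  \<open>B\<close> supplies that bound.\<close>

lemma abs_le_sup_norm:
  assumes "compact B" "continuous_on B f" "x \<in> B"
  shows "\<bar>f x\<bar> \<le> sup_norm B f"
proof -
  have "compact ((\<lambda>x. \<bar>f x\<bar>) ` B)"
    by (intro compact_continuous_image continuous_intros assms)
  then have "bdd_above ((\<lambda>x. \<bar>f x\<bar>) ` B)"
    by (intro bounded_imp_bdd_above compact_imp_bounded)
  then show ?thesis
    unfolding sup_norm_def using assms(3) by (rule cSUP_upper2) simp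
qed

text \<open>As \<open>ennreal\<close> sends negative reals to 0, the sign of \<open>R\<close> is
  what allows the \<open>ennreal\<close> inequality to be read back in the reals.\<close>

lemma holder_ball_abs_le:
  assumes "f \<in> holder_ball \<alpha> R B" "0 \<le> R" "x \<in> B"
  shows "\<bar>f x\<bar> \<le> R"
proof -
  have "ennreal \<bar>f x\<bar> \<le> (SUP x\<in>B. ennreal \<bar>f x\<bar>)"
    using assms(3) by (rule SUP_upper)
  also have "\<dots> \<le> ennreal R"
    using assms(1) by (simp add: holder_ball_def holder_norm_def)
  finally show ?thesis
    using assms(2) by simp
qed

lemma holder_ball_diff_le:
  assumes "f \<in> holder_ball \<alpha> R B" "0 \<le> R" "x \<in> B" "x' \<in> B"
  shows "\<bar>f x - f x'\<bar> \<le> R * norm (x - x') powr \<alpha>"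
\<comment> \<open>The supremum ranges over distinct points only; on the diagonal both sides are
  0.\<close>
proof (cases "x = x'")
  case False
  let ?S = "{(x, x'). x \<in> B \<and> x' \<in> B \<and> x \<noteq> x'}"
  let ?F = "\<lambda>(x, x'). ennreal (\<bar>f x - f x'\<bar> / norm (x - x') powr \<alpha>)"
  have "(x, x') \<in> ?S"
    using False assms by simp
  then have "?F (x, x') \<le> (SUP z\<in>?S. ?F z)"
    by (rule SUP_upper)
  also have "\<dots> \<le> ennreal R"
    using assms(1) by (simp add: holder_ball_def holder_norm_def)
  finally have "\<bar>f x - f x'\<bar> / norm (x - x') powr \<alpha> \<le> R"
    using assms(2) by simp
  then show ?thesis
    using False by (simp add: divide_le_eq)
qed simp

lemma set_integrable_section:
  fixes \<rho> :: "'a::euclidean_space \<times> 'b::euclidean_space \<Rightarrow> real"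
  assumes "compact D" "continuous_on (D \<times> E) \<rho>" "y \<in> E"
  shows "set_integrable lborel D (\<lambda>x. \<rho> (x, y))"
proof -
  have "continuous_on D (\<lambda>x. \<rho> (x, y))"
    by (rule continuous_on_compose2[OF assms(2)]) (use assms(3) in \<open>auto intro!: continuous_intros\<close>)
  then show ?thesis
    unfolding set_integrable_def by (rule borel_integrable_compact[OF assms(1)])
qed

text \<open>The infimum is a lower bound because the marginals, as integrals of a nonnegative
  density, are bounded below by 0.\<close>

lemma marginal_ge:
  fixes \<rho> :: "'a::euclidean_space \<times> 'b::euclidean_space \<Rightarrow> real"
  assumes "\<rho> \<in> X_space D E \<delta>" "y \<in> E"
  shows "\<delta> \<le> marginal D \<rho> y"
proof -
  have nonneg: "0 \<le> \<rho> z" if "z \<in> D \<times> E" for z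
    using assms(1) that by (auto simp: X_space_def C_ac_def)
  have "0 \<le> marginal D \<rho> y" if "y \<in> E" for y
    unfolding marginal_def set_lebesgue_integral_def
    by (rule Bochner_Integration.integral_nonneg) (use nonneg that in \<open>auto simp: indicator_def\<close>)
  then have "bdd_below (marginal D \<rho> ` E)"
    by (intro bdd_belowI[of _ 0]) auto
  then have "(INF y\<in>E. marginal D \<rho> y) \<le> marginal D \<rho> y"
    using assms(2) by (rule cINF_lower)
  then show ?thesis
    using assms(1) by (simp add: X_space_def)
qed

lemma marginal_diff_le:
  fixes p q :: "'a::euclidean_space \<times> 'b::euclidean_space \<Rightarrow> real"
  assumes "compact D" "continuous_on (D \<times> E) p" "continuous_on (D \<times> E) q"
    and "y \<in> E" "y' \<in> E"
    and le: "\<And>x. x \<in> D \<Longrightarrow> \<bar>p (x, y) - q (x, y')\<bar> \<le> K"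
  shows "\<bar>marginal D p y - marginal D q y'\<bar> \<le> measure lborel D * K"
proof -
  note int = set_integrable_section[OF assms(1,2,4)] set_integrable_section[OF assms(1,3,5)]
  have const: "set_integrable lborel D (\<lambda>x. K)"
    unfolding set_integrable_def by (rule borel_integrable_compact[OF assms(1)]) simp
  have "marginal D p y - marginal D q y' = (LINT x:D|lborel. p (x, y) - q (x, y'))"
    unfolding marginal_def using int by simp
  also have "\<bar>\<dots>\<bar> \<le> (LINT x:D|lborel. \<bar>p (x, y) - q (x, y')\<bar>)"
    using set_integral_norm_bound[OF set_integral_diff(1)[OF int]] by simp
  also have "\<dots> \<le> (LINT x:D|lborel. K)"
    using set_integrable_abs[OF set_integral_diff(1)[OF int]] const le by (rule set_integral_mono)
  also have "\<dots> = measure lborel D * K"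
    using assms(1) by (simp add: set_lebesgue_integral_def borel_compact)
  finally show ?thesis .
qed

text \<open>For \<open>t \<le> 1\<close> lowering the exponent from 1 to \<open>\<alpha>\<close>
  only increases the power; for larger \<open>t\<close> the power is at least 1 and the factor
  \<open>1 + R\<close> already exceeds \<open>t\<close>.\<close>

lemma le_powr_of_le:
  fixes t R \<alpha> :: real
  assumes "0 \<le> t" "t \<le> R" "0 < \<alpha>" "\<alpha> \<le> 1"
  shows "t \<le> (1 + R) * t powr \<alpha>"
proof (cases "t \<le> 1")
  case True
  have "t = t powr 1"
    using assms by simp
  also have "\<dots> \<le> 1 * t powr \<alpha>"
    using powr_mono'[of \<alpha> 1 t] assms True by simp
  also have "\<dots> \<le> (1 + R) * t powr \<alpha>"
    using assms by (intro mult_right_mono) auto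
  finally show ?thesis .
next
  case False
  then have "1 \<le> t powr \<alpha>"
    using assms by (simp add: ge_one_powr_ge_zero)
  then have "(1 + R) * 1 \<le> (1 + R) * t powr \<alpha>"
    using assms by (intro mult_left_mono) auto
  moreover have "t \<le> (1 + R) * 1"
    using assms by simp
  ultimately show ?thesis
    by (rule order_trans[rotated])
qed

lemma divide_diff_le:
  fixes a b m n :: real
  assumes "0 < \<delta>" "\<delta> \<le> m" "\<delta> \<le> n" "\<bar>b\<bar> \<le> R" "\<bar>a - b\<bar> \<le> K" "\<bar>m - n\<bar> \<le> V * K"
  shows "\<bar>a / m - b / n\<bar> \<le> K / \<delta> * (1 + V * R / \<delta>)"
proof -
  have pos: "0 < m" "0 < n"
    using assms by auto
  have "a / m - b / n = (a - b) / m + b * (n - m) / (m * n)"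
    using pos by (simp add: field_simps)
  also have "\<bar>\<dots>\<bar> \<le> \<bar>a - b\<bar> / m + \<bar>b\<bar> * \<bar>n - m\<bar> / (m * n)"
    using pos abs_triangle_ineq[of "(a - b) / m" "b * (n - m) / (m * n)"] by (simp add: abs_mult)
  \<comment> \<open>Both denominators are replaced by their lower bound \<open>\<delta>\<close>, and
    both terms then carry the common factor \<open>K / \<delta>\<close>.\<close>
  also have "\<dots> \<le> K / \<delta> + R * (V * K) / (\<delta> * \<delta>)"
    using assms pos by (intro add_mono frac_le mult_mono) (auto simp: abs_minus_commute)
  also have "\<dots> = K / \<delta> * (1 + V * R / \<delta>)"
    using assms(1) by (simp add: field_simps)
  finally show ?thesis .
qed

theorem corollary4p5:
  fixes D :: "(real ^ 'm) set" and E :: "(real ^ 'r) set"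
    and \<delta> \<alpha> R :: real
    and p q :: "(real ^ 'm) \<times> (real ^ 'r) \<Rightarrow> real"
    and y y' :: "real ^ 'r"
  assumes "compact D" "lipschitz_boundary D"
    and "compact E" "lipschitz_boundary E"
    and "\<delta> > 0"
    and "\<alpha> \<in> {0<..1}"
    and "R > 0"
    and "(p, y) \<in> (X_space D E \<delta> \<inter> holder_ball \<alpha> R (D \<times> E)) \<times> E"
    and "(q, y') \<in> (X_space D E \<delta> \<inter> holder_ball \<alpha> R (D \<times> E)) \<times> E"
  shows "sup_norm D (Psi_star D (p, y) - Psi_star D (q, y'))
    \<le> (1 + 2 * R) / \<delta> * (1 + measure lborel D * R / \<delta>)
        * prod_norm D E ((p, y) - (q, y')) powr \<alpha>"
proof -
  define N where "N = prod_norm D E ((p, y) - (q, y'))"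
  define K where "K = (1 + 2 * R) * N powr \<alpha>"
  have \<alpha>: "0 < \<alpha>" "\<alpha> \<le> 1"
    using assms(6) by auto
  have p: "p \<in> X_space D E \<delta>" "p \<in> holder_ball \<alpha> R (D \<times> E)" "y \<in> E"
    and q: "q \<in> X_space D E \<delta>" "q \<in> holder_ball \<alpha> R (D \<times> E)" "y' \<in> E"
    using assms(8,9) by auto
  have cont: "continuous_on (D \<times> E) p" "continuous_on (D \<times> E) q"
    using p(1) q(1) by (auto simp: X_space_def C_ac_def)
  have nonneg: "0 \<le> p z" "0 \<le> q z" if "z \<in> D \<times> E" for z
    using p(1) q(1) that by (auto simp: X_space_def C_ac_def)
  have N: "\<bar>p z - q z\<bar> \<le> N" if "z \<in> D \<times> E" for z
  proof -
    have "\<bar>(p - q) z\<bar> \<le> sup_norm (D \<times> E) (p - q)"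
      using that cont assms(1,3)
      by (intro abs_le_sup_norm) (auto simp: fun_diff_def intro!: compact_Times continuous_intros)
    then show ?thesis
      by (simp add: N_def prod_norm_def)
  qed
  have N_y: "norm (y - y') \<le> N"
    by (simp add: N_def prod_norm_def)
  have diff: "\<bar>p (x, y) - q (x, y')\<bar> \<le> K" if "x \<in> D" for x
  proof -
    let ?t = "\<bar>p (x, y) - q (x, y)\<bar>"
    have z: "(x, y) \<in> D \<times> E" "(x, y') \<in> D \<times> E"
      using that p(3) q(3) by auto
    \<comment> \<open>Nonnegativity of both densities matters: the triangle inequality alone gives
      \<open>2 * R\<close>, which would lead to \<open>1 + 3 * R\<close> in
      \<open>K\<close>.\<close>
    have "?t \<le> R"
      using nonneg[OF z(1)] holder_ball_abs_le[OF p(2) _ z(1)] holder_ball_abs_le[OF q(2) _ z(1)] assms(7)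
      by linarith
    then have "?t \<le> (1 + R) * ?t powr \<alpha>"
      using \<alpha> by (intro le_powr_of_le) auto
    also have "\<dots> \<le> (1 + R) * N powr \<alpha>"
      using N[OF z(1)] assms(7) \<alpha> by (intro mult_left_mono powr_mono2) auto
    finally have 1: "?t \<le> (1 + R) * N powr \<alpha>" .
    have "\<bar>q (x, y) - q (x, y')\<bar> \<le> R * norm ((x, y) - (x, y')) powr \<alpha>"
      using q(2) z assms(7) by (intro holder_ball_diff_le) auto
    \<comment> \<open>The two points share the coordinate \<open>x\<close>, so their distance is
      \<open>norm (y - y')\<close>.\<close>
    also have "\<dots> \<le> R * N powr \<alpha>"
      using N_y assms(7) \<alpha> by (intro mult_left_mono powr_mono2) (auto simp: norm_Pair)
    finally have 2: "\<bar>q (x, y) - q (x, y')\<bar> \<le> R * N powr \<alpha>" .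
    show ?thesis
      using 1 2 by (simp add: K_def algebra_simps)
  qed
  \<comment> \<open>Over an empty \<open>D\<close> the total mass would be 0 instead of 1. Bounding
    the real supremum pointwise requires a nonempty index set.\<close>
  have "D \<noteq> {}"
    using p(1) by (auto simp: X_space_def C_ac_def set_lebesgue_integral_def)
  then have "sup_norm D (Psi_star D (p, y) - Psi_star D (q, y'))
      \<le> K / \<delta> * (1 + measure lborel D * R / \<delta>)"
    unfolding sup_norm_def
  proof (rule cSUP_least)
    fix x assume x: "x \<in> D"
    have "\<bar>q (x, y')\<bar> \<le> R"
      using holder_ball_abs_le[OF q(2)] x q(3) assms(7) by simp
    then show "\<bar>(Psi_star D (p, y) - Psi_star D (q, y')) x\<bar>
        \<le> K / \<delta> * (1 + measure lborel D * R / \<delta>)"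
      unfolding Psi_star_def
      \<comment> \<open>The same \<open>K\<close> bounds the numerators and, with \<open>V\<close>
        the measure of \<open>D\<close>, the marginals.\<close>
      using divide_diff_le[OF assms(5) marginal_ge[OF p(1,3)] marginal_ge[OF q(1,3)] _ diff[OF x]
          marginal_diff_le[OF assms(1) cont p(3) q(3) diff]]
      by simp
  qed
  also have "\<dots> = (1 + 2 * R) / \<delta> * (1 + measure lborel D * R / \<delta>) * N powr \<alpha>"
    by (simp add: K_def)
  finally show ?thesis
    by (simp only: N_def)
qed

end
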